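(* Let $k\ge1$ be an integer, let $\alpha_k=\lfloor\frac{k+1}{2}\rfloor$ and $n_0(k)=\frac{(k-\alpha_k)(3k+3\alpha_k+1)}{2}$. For $n\ge n_0(k)$ and $0\le j\le 3k$ we have $$f_{k,j}(n)=\frac{1}{(3k)!}\sum_{J\subseteq\{\alpha_k+1,\ldots,k\}}\ \sum_{(j_1,\ldots,j_{3k+1})}\ \sum_{\ell=j}^{3k}\genfrac{[}{]}{0pt}{}{3k+1}{\ell+1}(-1)^{\ell-j}\binom{\ell}{j}D[k]^{-\ell}\bigl(a[k]_1j_1+\cdots+a[k]_{3k+1}j_{3k+1}\bigr)^{\ell-j}.$$ In particular, it follows that $$\mathcal{D}_k(n)=\frac{1}{(3k)!}\sum_{j=0}^{3k}\ \sum_{J\subseteq\{\alpha_k+1,\ldots,k\}}\ \sum_{(j_1,\ldots,j_{3k+1})}\ \sum_{\ell=j}^{3k}\genfrac{[}{]}{0pt}{}{3k+1}{\ell+1}(-1)^{\ell-j}\binom{\ell}{j}D[k]^{-\ell}\bigl(a[k]_1j_1+\cdots+a[k]_{3k+1}j_{3k+1}\bigr)^{\ell-j}(n-m_J)^j.$$ In both formulas $m_J=\sum_{i\in J}(3i-1)$ and, for each $J$, the sum over $(j_1,\ldots,j_{3k+1})$ runs over all integer tuples with $0\le j_i\le \frac{D[k]}{a[k]_i}-1$ for $1\le i\le 3k+1$ and $a[k]_1j_1+\cdots+a[k]_{3k+1}j_{3k+1}\equiv n-m_J\pmod{D[k]}$.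
   Context: A plane partition diamond of length $k$ of $n$ is a sequence $(a_1,a_2,\ldots,a_{3k+1})$ of nonnegative integers with $a_1+\cdots+a_{3k+1}=n$ such that, for all $0\le i\le k-1$, $a_{3i+1}\ge a_{3i+2}$, $a_{3i+1}\ge a_{3i+3}$, $a_{3i+2}\ge a_{3i+4}$, $a_{3i+3}\ge a_{3i+4}$. $\mathcal{D}_k(n)$ denotes the number of plane partition diamonds of length $k$ of $n$. For $k\ge1$, $\mathbf a[k]=(a[k]_1,\ldots,a[k]_{3k+1})$ is the sequence with $a[k]_j=j$ if $j\not\equiv 4\pmod 6$ and $a[k]_j=j/2$ if $j\equiv 4\pmod 6$. $D[k]=\operatorname{lcm}\{a[k]_1,\ldots,a[k]_{3k+1}\}$, which equals the least common multiple of $\{1\le j\le 3k+1 : j\not\equiv4\pmod 6\}$. The functions $f_{k,0},\ldots,f_{k,3k}$ are the periodic coefficients of $\mathcal{D}_k(n)$ as a quasi-polynomial of degree $3k$ with period $D[k]$: $\mathcal{D}_k(n)=f_{k,3k}(n)n^{3k}+\cdots+f_{k,1}(n)n+f_{k,0}(n)$ for all $n\ge n_0(k)$, where $f_{k,j}(n+D[k])=f_{k,j}(n)$ for all $n\ge n_0(k)$. $\genfrac{[}{]}{0pt}{}{r}{s}$ denotes the unsigned Stirling numbers of the first kind, i.e. $x(x+1)\cdots(x+r-1)=\sum_{s=0}^{r}\genfrac{[}{]}{0pt}{}{r}{s}x^s$. Convention: $0^0=1$. The set $J=\emptyset$ is allowed, with $m_\emptyset=0$.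
   Formalization: In the formula for f_{k,j}(n), the linear form a[k]_1 j_1+…+a[k]_{3k+1} j_{3k+1} raised to the power ℓ−j is replaced by that form plus m_J; as printed the formula is false for every k≥2 (e.g. at j=3k−1). The formula for D_k(n) is unchanged. *)

theory Defs
  imports
    Complex_Main
    "HOL-Library.FuncSet"
    "HOL-Number_Theory.Cong"
    "HOL-Combinatorics.Stirling"
begin

text \<open>
  Sequences \<open>(x\<^sub>1, \<dots>, x\<^sub>N)\<close> are extensional functions on \<open>{1..N}\<close>, so that
  indices start at 1 and sets of sequences have the expected cardinality.
\<close>

definition plane_partition_diamonds :: "nat \<Rightarrow> nat \<Rightarrow> (nat \<Rightarrow> nat) set" where
  "plane_partition_diamonds k n =
    {x \<in> {1..3*k+1} \<rightarrow>\<^sub>E UNIV.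
       (\<Sum>i=1..3*k+1. x i) = n \<and>
       (\<forall>i<k. x (3*i+1) \<ge> x (3*i+2) \<and> x (3*i+1) \<ge> x (3*i+3) \<and>
              x (3*i+2) \<ge> x (3*i+4) \<and> x (3*i+3) \<ge> x (3*i+4))}"

definition num_diamonds :: "nat \<Rightarrow> nat \<Rightarrow> nat" where
  "num_diamonds k n = card (plane_partition_diamonds k n)"

text \<open>
  The terms of \<open>\<^bold>a[k]\<close> depend on \<open>k\<close> only through the range \<open>1 \<le> j \<le> 3k+1\<close>
  of the index.
\<close>

definition dpart :: "nat \<Rightarrow> nat" where
  "dpart j = (if j mod 6 = 4 then j div 2 else j)"

definition dperiod :: "nat \<Rightarrow> nat" where
  "dperiod k = Lcm (dpart ` {1..3*k+1})"

definition dalpha :: "nat \<Rightarrow> nat" where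
  "dalpha k = (k + 1) div 2"

text \<open>The division is exact: \<open>k - \<alpha>\<close> and \<open>3k + 3\<alpha> + 1\<close> have opposite parity.\<close>

definition dthreshold :: "nat \<Rightarrow> nat" where
  "dthreshold k = (k - dalpha k) * (3*k + 3*dalpha k + 1) div 2"

text \<open>
  \<open>f j\<close> is the periodic coefficient of the \<open>j\<close>-th power. The values of \<open>f\<close> below
  the threshold are unconstrained.
\<close>

definition quasi_polynomial_coeffs :: "nat \<Rightarrow> (nat \<Rightarrow> nat \<Rightarrow> real) \<Rightarrow> bool" where
  "quasi_polynomial_coeffs k f \<longleftrightarrow>
    (\<forall>n\<ge>dthreshold k. real (num_diamonds k n) = (\<Sum>j=0..3*k. f j n * real n ^ j)) \<and>
    (\<forall>j\<le>3*k. \<forall>n\<ge>dthreshold k. f j (n + dperiod k) = f j n)"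

definition dshift :: "nat set \<Rightarrow> nat" where
  "dshift J = (\<Sum>i\<in>J. 3*i - 1)"

definition dlincomb :: "nat \<Rightarrow> (nat \<Rightarrow> nat) \<Rightarrow> nat" where
  "dlincomb k t = (\<Sum>i=1..3*k+1. dpart i * t i)"

definition dtuples :: "nat \<Rightarrow> nat \<Rightarrow> nat set \<Rightarrow> (nat \<Rightarrow> nat) set" where
  "dtuples k n J =
    {t \<in> (\<Pi>\<^sub>E i\<in>{1..3*k+1}. {0..dperiod k div dpart i - 1}).
       [int (dlincomb k t) = int n - int (dshift J)] (mod int (dperiod k))}"

text \<open>
  The closed form of \<open>\<D>\<^sub>k(n)\<close> expands in powers of \<open>n - m\<^sub>J\<close>, where
  \<open>m\<^sub>J = dshift J\<close>. Its coefficients therefore depend on \<open>J\<close>, and summing them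
  over \<open>J\<close> does not give the coefficients \<open>f\<^sub>k\<^sub>,\<^sub>j(n)\<close> of the powers of \<open>n\<close>
  unless \<open>k = 1\<close> or \<open>j = 3k\<close>. Re-expanding
  \<open>(n - m\<^sub>J - (a\<^sub>1 t\<^sub>1 + \<dots>))\<^sup>l\<close> in powers of \<open>n\<close> replaces the linear form
  \<open>a\<^sub>1 t\<^sub>1 + \<dots>\<close> by \<open>a\<^sub>1 t\<^sub>1 + \<dots> + m\<^sub>J\<close>. The source prints the formula for
  \<open>f\<^sub>k\<^sub>,\<^sub>j(n)\<close> without this summand \<open>m\<^sub>J\<close>; \<open>dcoeff_term\<close> takes the
  value of the linear form as its argument \<open>s\<close>, so that both formulas can be
  stated with it.
\<close>

definition dcoeff_term :: "nat \<Rightarrow> nat \<Rightarrow> nat \<Rightarrow> real" where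
  "dcoeff_term k j s =
    (\<Sum>l=j..3*k. real (stirling (3*k+1) (l+1)) * (-1) ^ (l - j) * real (l choose j)
       / real (dperiod k) ^ l * real s ^ (l - j))"

end

theory Submission
  imports Defs
begin

text \<open>
  Sorting the middle entries of each diamond and passing to successive differences shows
  that \<open>\<D>\<^sub>k(n)\<close> counts pairs of a set \<open>J \<subseteq> {1..k}\<close> and a solution of
  \<open>y\<^sub>1 + 2 y\<^sub>2 + \<dots> + (3k+1) y\<^bsub>3k+1\<^esub> = n - m\<^sub>J\<close>. The elements \<open>i \<le> \<alpha>\<close> of \<open>J\<close>
  can be absorbed into the unknown at index \<open>6i - 2\<close>, at the price of halving its weight. In the
  remaining equations \<open>\<Sum> a\<^sub>j z\<^sub>j = n - m\<^sub>J\<close> write \<open>z\<^sub>j = t\<^sub>j + (D / a\<^sub>j) w\<^sub>j\<close> with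
  \<open>0 \<le> t\<^sub>j < D / a\<^sub>j\<close>: for fixed \<open>t\<close> this prescribes the value \<open>q\<close> of
  \<open>w\<^sub>1 + \<dots> + w\<^bsub>3k+1\<^esub>\<close>, so there are \<open>(q+1) \<dots> (q+3k) / (3k)!\<close> solutions, and Stirling
  numbers and the binomial theorem expand this in powers of \<open>n - m\<^sub>J\<close> or of \<open>n\<close>. The
  coefficients of the latter expansion are periodic, hence they are the only possible ones.
\<close>

section \<open>Fibre counts and finiteness of solution sets\<close>

lemma card_eq_sum_fibers:
  assumes "finite A" "finite B" "f ` A \<subseteq> B"
  shows "card A = (\<Sum>b\<in>B. card {x \<in> A. f x = b})"
  using sum.group[OF assms, of "\<lambda>_. 1::nat"] by simp

text \<open>The offset \<open>m\<close> stands on the left instead of being subtracted from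
  \<open>n\<close>, so no truncated subtraction occurs and the set is empty when
  \<open>m > n\<close>.\<close>

definition weighted_solutions :: "nat \<Rightarrow> (nat \<Rightarrow> nat) \<Rightarrow> nat \<Rightarrow> nat \<Rightarrow> (nat \<Rightarrow> nat) set" where
  "weighted_solutions N a m n = {x \<in> {1..N} \<rightarrow>\<^sub>E UNIV. (\<Sum>i=1..N. a i * x i) + m = n}"

lemma finite_weighted_solutions:
  assumes "\<And>i. i \<in> {1..N} \<Longrightarrow> a i > 0"
  shows "finite (weighted_solutions N a m n)"
proof (rule finite_subset)
  show "weighted_solutions N a m n \<subseteq> {1..N} \<rightarrow>\<^sub>E {..n}"
  proof
    fix x assume x: "x \<in> weighted_solutions N a m n"
    have "x i \<le> n" if i: "i \<in> {1..N}" for i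
    proof -
      have "x i \<le> a i * x i" using assms[OF i] by simp
      also have "\<dots> \<le> (\<Sum>i=1..N. a i * x i)"
        using i by (intro member_le_sum) auto
      also have "\<dots> \<le> n" using x by (auto simp: weighted_solutions_def)
      finally show ?thesis .
    qed
    with x show "x \<in> {1..N} \<rightarrow>\<^sub>E {..n}"
      by (auto simp: weighted_solutions_def PiE_iff)
  qed
qed (auto intro: finite_PiE)

lemma finite_plane_partition_diamonds: "finite (plane_partition_diamonds k n)"
  by (rule finite_subset[OF _ finite_weighted_solutions[of "3*k+1" "\<lambda>_. 1" 0 n]])
     (auto simp: weighted_solutions_def plane_partition_diamonds_def)

subsection \<open>From diamonds to partitions with marked descents\<close>

text \<open>Strict descents are recorded as numerical minimal drops \<open>e i\<close>, which makes
  passing to differences a mere translation by \<open>e\<close>.\<close>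

definition step_chains :: "nat \<Rightarrow> (nat \<Rightarrow> nat) \<Rightarrow> nat \<Rightarrow> (nat \<Rightarrow> nat) set" where
  "step_chains N e n = {x \<in> {1..N} \<rightarrow>\<^sub>E UNIV.
     (\<Sum>i=1..N. x i) = n \<and> (\<forall>i\<in>{1..<N}. x (Suc i) + e i \<le> x i)}"

text \<open>Each \<open>v i\<close> lies in exactly the \<open>i\<close> tails that start at
  \<open>1\<close>, ..., \<open>i\<close>.\<close>

lemma sum_tails:
  fixes v :: "nat \<Rightarrow> nat"
  shows "(\<Sum>j=1..N. \<Sum>i=j..N. v i) = (\<Sum>i=1..N. i * v i)"
proof (induction N)
  case (Suc N)
  have "(\<Sum>j=1..Suc N. \<Sum>i=j..Suc N. v i) = (\<Sum>j=1..N. (\<Sum>i=j..N. v i) + v (Suc N)) + v (Suc N)"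
    by simp
  also have "\<dots> = (\<Sum>i=1..N. i * v i) + Suc N * v (Suc N)"
    using Suc by (simp add: sum.distrib)
  finally show ?case by simp
qed simp

text \<open>Monotonicity keeps the subtraction on naturals from truncating, so the sum telescopes as
  it does over the integers.\<close>

lemma telescope_chain:
  fixes L :: "nat \<Rightarrow> nat"
  assumes "j \<le> N" and "L (Suc N) = 0" and "\<And>i. j \<le> i \<Longrightarrow> i \<le> N \<Longrightarrow> L (Suc i) \<le> L i"
  shows "(\<Sum>i=j..N. L i - L (Suc i)) = L j"
  using assms
proof (induction rule: inc_induct)
  case (step m)
  have "(\<Sum>i=m..N. L i - L (Suc i)) = (L m - L (Suc m)) + L (Suc m)"
    using step by (subst sum.atLeast_Suc_atMost) auto
  then show ?case using step.prems(2)[of m] step.hyps by simp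
qed simp

text \<open>Here \<open>y i\<close> is the excess of the \<open>i\<close>-th drop over
  \<open>e i\<close>, and an entry of the chain is the sum of all later drops. By
  \<open>sum_tails\<close> the drop at \<open>i\<close> counts \<open>i\<close> times in the total,
  and the forced part of the drops becomes the offset.\<close>

lemma bij_betw_step_chains:
  assumes e: "e N = 0"
  shows "bij_betw (\<lambda>y. \<lambda>j\<in>{1..N}. \<Sum>i=j..N. y i + e i)
           (weighted_solutions N (\<lambda>i. i) (\<Sum>i=1..N. i * e i) n) (step_chains N e n)"
proof (rule bij_betw_byWitness[where f' =
      "\<lambda>x. \<lambda>j\<in>{1..N}. x j - (if j < N then x (Suc j) else 0) - e j"])
  let ?L = "\<lambda>y j. \<Sum>i=j..N. y i + e i"
  have L: "?L y j = (y j + e j) + ?L y (Suc j)" if "j \<in> {1..N}" for y j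
    using that by (subst sum.atLeast_Suc_atMost) auto
  show "\<forall>y\<in>weighted_solutions N (\<lambda>i. i) (\<Sum>i=1..N. i * e i) n.
      (\<lambda>j\<in>{1..N}. (\<lambda>j\<in>{1..N}. ?L y j) j -
        (if j < N then (\<lambda>j\<in>{1..N}. ?L y j) (Suc j) else 0) - e j) = y"
  proof
    fix y assume "y \<in> weighted_solutions N (\<lambda>i. i) (\<Sum>i=1..N. i * e i) n"
    then have ext: "y \<in> extensional {1..N}" by (auto simp: weighted_solutions_def PiE_iff)
    show "(\<lambda>j\<in>{1..N}. (\<lambda>j\<in>{1..N}. ?L y j) j -
        (if j < N then (\<lambda>j\<in>{1..N}. ?L y j) (Suc j) else 0) - e j) = y"
      by (rule extensionalityI[OF _ ext]) (use L[of _ y] in auto)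
  qed
  show "(\<lambda>y. \<lambda>j\<in>{1..N}. ?L y j) ` weighted_solutions N (\<lambda>i. i) (\<Sum>i=1..N. i * e i) n
      \<subseteq> step_chains N e n"
  proof (rule image_subsetI)
    fix y assume y: "y \<in> weighted_solutions N (\<lambda>i. i) (\<Sum>i=1..N. i * e i) n"
    have "(\<Sum>j=1..N. ?L y j) = n"
      using y unfolding sum_tails
      by (auto simp: weighted_solutions_def algebra_simps sum.distrib)
    moreover have "?L y (Suc j) + e j \<le> ?L y j" if "j \<in> {1..<N}" for j
      using L[of j y] that by simp
    ultimately show "(\<lambda>j\<in>{1..N}. ?L y j) \<in> step_chains N e n"
      by (simp add: step_chains_def)
  qed
  have tail: "(\<Sum>i=j..N. x i - (if i < N then x (Suc i) else 0)) = x j"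
    if x: "x \<in> step_chains N e n" and j: "j \<in> {1..N}" for x j
  proof -
    \<comment> \<open>Extending \<open>x\<close> by \<open>0\<close> past \<open>N\<close> provides
      the zero end value that telescoping requires.\<close>
    let ?M = "\<lambda>i. if i \<le> N then x i else 0"
    have "x (Suc i) \<le> x i" if "i \<in> {1..<N}" for i
    proof -
      have "x (Suc i) + e i \<le> x i" using x that by (simp add: step_chains_def)
      then show ?thesis by simp
    qed
    then have "(\<Sum>i=j..N. ?M i - ?M (Suc i)) = ?M j"
      using j by (intro telescope_chain) auto
    moreover have "(\<Sum>i=j..N. ?M i - ?M (Suc i)) = (\<Sum>i=j..N. x i - (if i < N then x (Suc i) else 0))"
      by (intro sum.cong) auto
    ultimately show ?thesis using j by simp
  qed
  have restore: "?L (\<lambda>j\<in>{1..N}. x j - (if j < N then x (Suc j) else 0) - e j) j = x j"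
    if x: "x \<in> step_chains N e n" and j: "j \<in> {1..N}" for x j
  proof -
    \<comment> \<open>Subtracting \<open>e i\<close> does not truncate; at the last place this is
      where \<open>e N = 0\<close> enters.\<close>
    have ge: "e i \<le> x i - (if i < N then x (Suc i) else 0)" if "i \<in> {j..N}" for i
    proof (cases "i < N")
      case True
      then have "x (Suc i) + e i \<le> x i" using x that j by (auto simp: step_chains_def)
      then show ?thesis using True by simp
    next
      case False
      then show ?thesis using that e by simp
    qed
    have "?L (\<lambda>j\<in>{1..N}. x j - (if j < N then x (Suc j) else 0) - e j) j
        = (\<Sum>i=j..N. x i - (if i < N then x (Suc i) else 0))"
    proof (intro sum.cong refl)
      fix i assume i: "i \<in> {j..N}"
      then have "i \<in> {1..N}" using j by simp
      then show "(\<lambda>j\<in>{1..N}. x j - (if j < N then x (Suc j) else 0) - e j) i + e i =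
          x i - (if i < N then x (Suc i) else 0)"
        using ge[OF i] by (simp only: restrict_apply' le_add_diff_inverse2)
    qed
    then show ?thesis using tail[OF x j] by simp
  qed
  show "\<forall>x\<in>step_chains N e n. (\<lambda>j\<in>{1..N}.
      ?L (\<lambda>j\<in>{1..N}. x j - (if j < N then x (Suc j) else 0) - e j) j) = x"
  proof
    fix x assume x: "x \<in> step_chains N e n"
    then have ext: "x \<in> extensional {1..N}" by (auto simp: step_chains_def PiE_iff)
    show "(\<lambda>j\<in>{1..N}.
      ?L (\<lambda>j\<in>{1..N}. x j - (if j < N then x (Suc j) else 0) - e j) j) = x"
      by (rule extensionalityI[OF _ ext]) (use restore[OF x] in auto)
  qed
  show "(\<lambda>x. \<lambda>j\<in>{1..N}. x j - (if j < N then x (Suc j) else 0) - e j) ` step_chains N e n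
      \<subseteq> weighted_solutions N (\<lambda>i. i) (\<Sum>i=1..N. i * e i) n"
  proof (rule image_subsetI)
    fix x assume x: "x \<in> step_chains N e n"
    let ?y = "\<lambda>j\<in>{1..N}. x j - (if j < N then x (Suc j) else 0) - e j"
    have "n = (\<Sum>j=1..N. ?L ?y j)"
      using x restore[OF x] by (auto simp: step_chains_def)
    also have "\<dots> = (\<Sum>i=1..N. i * (?y i + e i))" by (rule sum_tails)
    finally show "?y \<in> weighted_solutions N (\<lambda>i. i) (\<Sum>i=1..N. i * e i) n"
      by (simp add: weighted_solutions_def algebra_simps sum.distrib)
  qed
qed

lemma card_step_chains:
  "e N = 0 \<Longrightarrow> card (step_chains N e n) = card (weighted_solutions N (\<lambda>i. i) (\<Sum>i=1..N. i * e i) n)"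
  using bij_betw_same_card[OF bij_betw_step_chains] by metis

text \<open>
  Swapping the two middle entries of every diamond in which they are out of order turns a
  plane partition diamond into a chain; the set \<open>J\<close> of swapped diamonds is exactly the set
  of places where the chain is required to descend strictly.
\<close>

definition flips :: "nat \<Rightarrow> (nat \<Rightarrow> nat) \<Rightarrow> nat set" where
  "flips k x = {i \<in> {1..k}. x (3*i-1) < x (3*i)}"

definition flip :: "nat set \<Rightarrow> nat \<Rightarrow> nat" where
  "flip J j = (if j mod 3 = 2 \<and> (j+1) div 3 \<in> J then j + 1
               else if j mod 3 = 0 \<and> j div 3 \<in> J then j - 1 else j)"

text \<open>Evaluation at the four corners of the diamond with zero-based number \<open>i\<close>,
  so that later arguments avoid \<open>div\<close> and \<open>mod\<close>. The corner
  \<open>3*i+4\<close> is also the first corner of the next diamond.\<close>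

lemma flip_simps:
  "flip J (3*i+1) = 3*i+1"
  "flip J (3*i+2) = (if Suc i \<in> J then 3*i+3 else 3*i+2)"
  "flip J (3*i+3) = (if Suc i \<in> J then 3*i+2 else 3*i+3)"
  "flip J (3*i+4) = 3*i+4"
proof -
  have "(3*i+1) mod 3 = 1" "(3*i+2) mod 3 = 2" "(3*i+3) mod 3 = 0" "(3*i+4) mod 3 = 1"
     "(3*i+2+1) div 3 = Suc i" "(3*i+3) div 3 = Suc i" by presburger+
  then show "flip J (3*i+1) = 3*i+1"
  "flip J (3*i+2) = (if Suc i \<in> J then 3*i+3 else 3*i+2)"
  "flip J (3*i+3) = (if Suc i \<in> J then 3*i+2 else 3*i+3)"
  "flip J (3*i+4) = 3*i+4" by (auto simp: flip_def)
qed

lemma triple_cases: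
  fixes j k :: nat
  assumes "j \<in> {1..3*k+1}"
  obtains i where "i \<le> k" "j = 3*i+1" | i where "i < k" "j = 3*i+2" | i where "i < k" "j = 3*i+3"
proof -
  define i where "i = (j - 1) div 3"
  have "(j = 3*i+1 \<and> i \<le> k) \<or> (j = 3*i+2 \<and> i < k) \<or> (j = 3*i+3 \<and> i < k)"
    using assms unfolding i_def by auto
  then show ?thesis using that by blast
qed

lemma flip_in_range: "j \<in> {1..3*k+1} \<Longrightarrow> flip J j \<in> {1..3*k+1}"
  by (erule triple_cases) (auto simp only: flip_simps atLeastAtMost_iff split: if_splits)

lemma flip_flip: "j \<in> {1..3*k+1} \<Longrightarrow> flip J (flip J j) = j"
  by (erule triple_cases) (auto simp only: flip_simps split: if_splits)

lemma bij_betw_flip: "bij_betw (flip J) {1..3*k+1} {1..3*k+1}"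
  by (rule bij_betw_byWitness[where f' = "flip J"]) (use flip_flip flip_in_range in blast)+

definition flip_step :: "nat set \<Rightarrow> nat \<Rightarrow> nat" where
  "flip_step J j = of_bool (j mod 3 = 2 \<and> (j+1) div 3 \<in> J)"

lemma flip_step_simps:
  "flip_step J (3*i+1) = 0"
  "flip_step J (3*i+2) = of_bool (Suc i \<in> J)"
  "flip_step J (3*i+3) = 0"
proof -
  have "(3*i+1) mod 3 = 1" "(3*i+2) mod 3 = 2" "(3*i+3) mod 3 = 0"
     "(3*i+2+1) div 3 = Suc i" by presburger+
  then show "flip_step J (3*i+1) = 0"
  "flip_step J (3*i+2) = of_bool (Suc i \<in> J)"
  "flip_step J (3*i+3) = 0" by (auto simp: flip_step_def)
qed

text \<open>Groups the chain condition diamond by diamond, the form in which it can be compared with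
  the inequalities of a plane partition diamond.\<close>

lemma step_chains_flip_step_iff:
  "x \<in> step_chains (3*k+1) (flip_step J) n \<longleftrightarrow>
    x \<in> {1..3*k+1} \<rightarrow>\<^sub>E UNIV \<and> (\<Sum>i=1..3*k+1. x i) = n \<and>
    (\<forall>i<k. x (3*i+2) \<le> x (3*i+1) \<and> x (3*i+3) + of_bool (Suc i \<in> J) \<le> x (3*i+2) \<and>
           x (3*i+4) \<le> x (3*i+3))"
proof -
  have "(\<forall>j\<in>{1..<3*k+1}. x (Suc j) + flip_step J j \<le> x j) \<longleftrightarrow>
    (\<forall>i<k. x (3*i+2) \<le> x (3*i+1) \<and> x (3*i+3) + of_bool (Suc i \<in> J) \<le> x (3*i+2) \<and>
           x (3*i+4) \<le> x (3*i+3))" (is "?l \<longleftrightarrow> ?r")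
  proof
    assume l: ?l
    show ?r
    proof (intro allI impI)
      fix i assume i: "i < k"
      have *: "3*i+1 \<in> {1..<3*k+1}" "3*i+2 \<in> {1..<3*k+1}" "3*i+3 \<in> {1..<3*k+1}"
        using i by auto
      show "x (3*i+2) \<le> x (3*i+1) \<and> x (3*i+3) + of_bool (Suc i \<in> J) \<le> x (3*i+2) \<and>
           x (3*i+4) \<le> x (3*i+3)"
        using l[rule_format, OF *(1)] l[rule_format, OF *(2)] l[rule_format, OF *(3)]
        unfolding flip_step_simps by (simp add: numeral_eq_Suc)
    qed
  next
    assume r: ?r
    show ?l
    proof
      fix j assume "j \<in> {1..<3*k+1}"
      then have j: "j \<in> {1..3*k+1}" "j < 3*k+1" by auto
      from j(1) show "x (Suc j) + flip_step J j \<le> x j"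
      proof (cases rule: triple_cases)
        case (1 i)
        then have "i < k" using j(2) by simp
        with r have "x (3*i+2) \<le> x (3*i+1)" by blast
        then show ?thesis unfolding 1 flip_step_simps by simp
      next
        case (2 i)
        with r have "x (3*i+3) + of_bool (Suc i \<in> J) \<le> x (3*i+2)" by blast
        then show ?thesis unfolding 2 flip_step_simps by (simp add: numeral_eq_Suc)
      next
        case (3 i)
        with r have "x (3*i+4) \<le> x (3*i+3)" by blast
        then show ?thesis unfolding 3 flip_step_simps by (simp add: numeral_eq_Suc)
      qed
    qed
  qed
  then show ?thesis unfolding step_chains_def by blast
qed

lemma flips_eq_iff:
  assumes "J \<subseteq> {1..k}"
  shows "flips k x = J \<longleftrightarrow> (\<forall>i<k. Suc i \<in> J \<longleftrightarrow> x (3*i+2) < x (3*i+3))"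
proof -
  have "flips k x = J \<longleftrightarrow> (\<forall>i\<in>{1..k}. i \<in> J \<longleftrightarrow> x (3*i-1) < x (3*i))"
    using assms by (auto simp: flips_def)
  also have "\<dots> \<longleftrightarrow> (\<forall>i<k. Suc i \<in> J \<longleftrightarrow> x (3*Suc i-1) < x (3*Suc i))"
    unfolding image_Suc_lessThan[symmetric] by blast
  also have "\<dots> \<longleftrightarrow> (\<forall>i<k. Suc i \<in> J \<longleftrightarrow> x (3*i+2) < x (3*i+3))"
    by (simp add: numeral_eq_Suc)
  finally show ?thesis .
qed

text \<open>Permuting indices by \<open>flip J\<close> is an involution, so one map serves in both
  directions. Ties between middle entries stay unswapped; hence the drop is at least 1 exactly in
  the swapped diamonds, and \<open>J\<close> can be recovered from the original order.\<close>

lemma card_diamonds_flips: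
  assumes J: "J \<subseteq> {1..k}"
  shows "card {x \<in> plane_partition_diamonds k n. flips k x = J} = card (step_chains (3*k+1) (flip_step J) n)"
proof (rule bij_betw_same_card)
  let ?N = "3*k+1"
  let ?F = "\<lambda>x::nat \<Rightarrow> nat. \<lambda>j\<in>{1..?N}. x (flip J j)"
  have invol: "?F (?F x) = x" if "x \<in> {1..?N} \<rightarrow>\<^sub>E UNIV" for x
  proof (rule extensionalityI[of _ "{1..?N}"])
    show "?F (?F x) j = x j" if "j \<in> {1..?N}" for j
      using flip_in_range[OF that, of J] flip_flip[OF that, of J] that
      by (simp only: restrict_apply')
  qed (use that in \<open>simp_all add: PiE_iff\<close>)
  have sum: "(\<Sum>j=1..?N. ?F x j) = (\<Sum>j=1..?N. x j)" for x
    using sum.reindex_bij_betw[OF bij_betw_flip[of J k], of x] by simp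
  have F: "?F x (3*i+1) = x (3*i+1)"
      "?F x (3*i+2) = (if Suc i \<in> J then x (3*i+3) else x (3*i+2))"
      "?F x (3*i+3) = (if Suc i \<in> J then x (3*i+2) else x (3*i+3))"
      "?F x (3*i+4) = x (3*i+4)" if "i < k" for x i
  proof -
    have "3*i+1 \<in> {1..?N}" "3*i+2 \<in> {1..?N}" "3*i+3 \<in> {1..?N}" "3*i+4 \<in> {1..?N}"
      using that by auto
    then show "?F x (3*i+1) = x (3*i+1)"
      "?F x (3*i+2) = (if Suc i \<in> J then x (3*i+3) else x (3*i+2))"
      "?F x (3*i+3) = (if Suc i \<in> J then x (3*i+2) else x (3*i+3))"
      "?F x (3*i+4) = x (3*i+4)"
      by (simp_all only: restrict_apply' flip_simps if_distrib[of x])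
  qed
  have ext: "?F x \<in> {1..?N} \<rightarrow>\<^sub>E UNIV" for x by (simp add: restrict_PiE_iff)
  show "bij_betw ?F {x \<in> plane_partition_diamonds k n. flips k x = J} (step_chains ?N (flip_step J) n)"
  proof (rule bij_betw_byWitness[where f' = ?F])
    show "\<forall>x\<in>{x \<in> plane_partition_diamonds k n. flips k x = J}. ?F (?F x) = x"
      using invol by (simp add: plane_partition_diamonds_def)
    show "\<forall>x\<in>step_chains ?N (flip_step J) n. ?F (?F x) = x"
      using invol by (simp add: step_chains_def)
    show "?F ` {x \<in> plane_partition_diamonds k n. flips k x = J} \<subseteq> step_chains ?N (flip_step J) n"
    proof (rule image_subsetI)
      fix x assume x: "x \<in> {x \<in> plane_partition_diamonds k n. flips k x = J}"
      then have d: "\<forall>i<k. x (3*i+1) \<ge> x (3*i+2) \<and> x (3*i+1) \<ge> x (3*i+3) \<and>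
              x (3*i+2) \<ge> x (3*i+4) \<and> x (3*i+3) \<ge> x (3*i+4)"
        and s: "(\<Sum>i=1..?N. x i) = n"
        and f: "\<forall>i<k. Suc i \<in> J \<longleftrightarrow> x (3*i+2) < x (3*i+3)"
        by (auto simp: plane_partition_diamonds_def flips_eq_iff[OF J])
      have "\<forall>i<k. ?F x (3*i+2) \<le> ?F x (3*i+1) \<and>
           ?F x (3*i+3) + of_bool (Suc i \<in> J) \<le> ?F x (3*i+2) \<and> ?F x (3*i+4) \<le> ?F x (3*i+3)"
        using d f by (intro allI impI) (simp only: F, auto)
      then show "?F x \<in> step_chains ?N (flip_step J) n"
        using ext s sum unfolding step_chains_flip_step_iff by blast
    qed
    show "?F ` step_chains ?N (flip_step J) n \<subseteq> {x \<in> plane_partition_diamonds k n. flips k x = J}"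
    proof (rule image_subsetI)
      fix x assume x: "x \<in> step_chains ?N (flip_step J) n"
      then have d: "\<forall>i<k. x (3*i+2) \<le> x (3*i+1) \<and> x (3*i+3) + of_bool (Suc i \<in> J) \<le> x (3*i+2) \<and>
           x (3*i+4) \<le> x (3*i+3)"
        and s: "(\<Sum>i=1..?N. x i) = n"
        unfolding step_chains_flip_step_iff by blast+
      have "?F x (3*i+1) \<ge> ?F x (3*i+2) \<and> ?F x (3*i+1) \<ge> ?F x (3*i+3) \<and>
              ?F x (3*i+2) \<ge> ?F x (3*i+4) \<and> ?F x (3*i+3) \<ge> ?F x (3*i+4)"
           "Suc i \<in> J \<longleftrightarrow> ?F x (3*i+2) < ?F x (3*i+3)" if i: "i < k" for i
        using d[rule_format, OF i] by (simp_all only: F[OF i]) (auto split: if_splits)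
      then have "?F x \<in> plane_partition_diamonds k n" "flips k (?F x) = J"
        using ext s sum unfolding plane_partition_diamonds_def flips_eq_iff[OF J] by blast+
      then show "?F x \<in> {x \<in> plane_partition_diamonds k n. flips k x = J}" by blast
    qed
  qed
qed

text \<open>A forced unit drop at index \<open>3*i-1\<close> raises the first \<open>3*i-1\<close>
  entries by one, which is the contribution of \<open>i\<close> to \<open>dshift J\<close>.\<close>

lemma sum_flip_step:
  assumes "J \<subseteq> {1..k}"
  shows "(\<Sum>j=1..3*k+1. j * flip_step J j) = dshift J"
proof -
  have "(\<Sum>j=1..3*k+1. j * flip_step J j) =
      (\<Sum>j | j \<in> {1..3*k+1} \<and> j mod 3 = 2 \<and> (j+1) div 3 \<in> J. j)"
    unfolding flip_step_def by (rule sum.mono_neutral_cong_right) auto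
  also have "\<dots> = dshift J"
    unfolding dshift_def
  proof (rule sum.reindex_bij_witness[where i = "\<lambda>i. 3*i-1" and j = "\<lambda>j. (j+1) div 3"])
    fix i assume i: "i \<in> J"
    then have i1: "1 \<le> i" "i \<le> k" using assms by auto
    then show eq: "(3*i-1+1) div 3 = i" by simp
    have "3*i-1 = 2 + 3*(i-1)" using i1(1) by simp
    then have "(3*i-1) mod 3 = 2" by (simp only: mod_mult_self2) simp
    moreover have "3*i-1 \<in> {1..3*k+1}" unfolding atLeastAtMost_iff using i1 by linarith
    ultimately show "3*i-1 \<in> {j \<in> {1..3*k+1}. j mod 3 = 2 \<and> (j+1) div 3 \<in> J}"
      using i eq by simp
  next
    fix j assume "j \<in> {j \<in> {1..3*k+1}. j mod 3 = 2 \<and> (j+1) div 3 \<in> J}"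
    then have j: "j mod 3 = 2" "(j+1) div 3 \<in> J" by auto
    show "(j+1) div 3 \<in> J" by fact
    show "3*((j+1) div 3) - 1 = j" using j(1) by presburger
    then show "3*((j+1) div 3) - 1 = j" .
  qed
  finally show ?thesis .
qed

text \<open>Sorting the diamonds by \<open>flips\<close> gives the coefficient form of the
  generating function whose numerator is the product of the factors 1 + q^(3i-1) for 1 \<le> i \<le>
  k and whose denominator is the product of the factors 1 - q^j for 1 \<le> j \<le> 3k+1.\<close>

lemma num_diamonds_eq_sum:
  "num_diamonds k n =
    (\<Sum>J\<in>Pow {1..k}. card (weighted_solutions (3*k+1) (\<lambda>i. i) (dshift J) n))"
proof -
  have "num_diamonds k n = (\<Sum>J\<in>Pow {1..k}. card {x \<in> plane_partition_diamonds k n. flips k x = J})"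
    unfolding num_diamonds_def
    by (intro card_eq_sum_fibers finite_plane_partition_diamonds) (auto simp: flips_def)
  also have "\<dots> = (\<Sum>J\<in>Pow {1..k}. card (weighted_solutions (3*k+1) (\<lambda>i. i) (dshift J) n))"
    \<comment> \<open>The condition \<open>e N = 0\<close> holds because the last index 3k+1 is 1
      modulo 3, so no drop is forced there.\<close>
    by (intro sum.cong refl, subst card_diamonds_flips, blast, subst card_step_chains)
       (auto simp: flip_step_simps sum_flip_step simp del: One_nat_def)
  finally show ?thesis .
qed

subsection \<open>Cancelling the factors with index up to \<open>\<alpha>\<close>\<close>

text \<open>
  This is the bijective form of \<open>(1 + q\<^sup>m) / (1 - q\<^bsup>2m\<^esup>) = 1 / (1 - q\<^sup>m)\<close> for
  \<open>m = 3i - 1\<close>, \<open>i \<le> \<alpha>\<close>: the bit \<open>i \<in> K\<close> becomes the parity of the multiplicity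
  at index \<open>6i - 2\<close>.
\<close>

lemma dpart_pos: "j > 0 \<Longrightarrow> dpart j > 0"
  unfolding dpart_def by auto

lemma mod6_eq_4D:
  fixes j :: nat
  assumes "j mod 6 = 4"
  shows "6 * ((j+2) div 6) = j + 2"
proof -
  have "j = 4 + 6 * (j div 6)" using mult_div_mod_eq[of 6 j] assms by linarith
  then obtain q where "j = 4 + 6 * q" ..
  then show ?thesis by simp
qed

text \<open>6i - 2 \<le> 3k + 1 amounts to i \<le> (k+1)/2, which is where \<alpha> comes from: it
  counts the indices that are 4 modulo 6.\<close>

lemma dalpha_index:
  fixes j k :: nat
  assumes "j \<in> {1..3*k+1}" "j mod 6 = 4"
  shows "(j+2) div 6 \<in> {1..dalpha k}"
  using mod6_eq_4D[OF assms(2)] assms(1) unfolding dalpha_def atLeastAtMost_iff by linarith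

definition merge_step :: "nat set \<Rightarrow> nat \<Rightarrow> nat" where
  "merge_step K j = of_bool (j mod 6 = 4 \<and> (j+2) div 6 \<in> K)"

text \<open>A bit at index \<open>6*i-2\<close> has the halved weight \<open>3*i-1\<close>, which is
  the summand of \<open>i\<close> in \<open>dshift K\<close>.\<close>

lemma sum_merge_step:
  assumes "K \<subseteq> {1..dalpha k}"
  shows "(\<Sum>j=1..3*k+1. dpart j * merge_step K j) = dshift K"
proof -
  have "(\<Sum>j=1..3*k+1. dpart j * merge_step K j) =
      (\<Sum>j | j \<in> {1..3*k+1} \<and> j mod 6 = 4 \<and> (j+2) div 6 \<in> K. j div 2)"
    unfolding merge_step_def dpart_def by (rule sum.mono_neutral_cong_right) auto
  also have "\<dots> = dshift K"
    unfolding dshift_def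
  proof (rule sum.reindex_bij_witness[where i = "\<lambda>i. 6*i-2" and j = "\<lambda>j. (j+2) div 6"])
    fix i assume i: "i \<in> K"
    then have i1: "1 \<le> i" "i \<le> (k+1) div 2" using assms by (auto simp: dalpha_def)
    then show eq: "(6*i-2+2) div 6 = i" by simp
    have "6*i-2 = 4 + 6*(i-1)" using i1(1) by simp
    then have "(6*i-2) mod 6 = 4" by (simp only: mod_mult_self2) simp
    moreover have "6*i-2 \<in> {1..3*k+1}" unfolding atLeastAtMost_iff using i1 by linarith
    ultimately show "6*i-2 \<in> {j \<in> {1..3*k+1}. j mod 6 = 4 \<and> (j+2) div 6 \<in> K}"
      using i eq by simp
  next
    fix j assume "j \<in> {j \<in> {1..3*k+1}. j mod 6 = 4 \<and> (j+2) div 6 \<in> K}"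
    then have j: "j mod 6 = 4" "(j+2) div 6 \<in> K" by auto
    show "(j+2) div 6 \<in> K" by fact
    show "6*((j+2) div 6) - 2 = j" using mod6_eq_4D[OF j(1)] by linarith
    show "3*((j+2) div 6) - 1 = j div 2" using mod6_eq_4D[OF j(1)] by linarith
  qed
  finally show ?thesis .
qed

definition odd_parts :: "nat \<Rightarrow> (nat \<Rightarrow> nat) \<Rightarrow> nat set" where
  "odd_parts k z = {i \<in> {1..dalpha k}. odd (z (6*i-2))}"

lemma odd_parts_eq_iff:
  assumes "K \<subseteq> {1..dalpha k}"
  shows "odd_parts k z = K \<longleftrightarrow>
    (\<forall>j\<in>{1..3*k+1}. j mod 6 = 4 \<longrightarrow> z j mod 2 = merge_step K j)"
proof
  assume K: "odd_parts k z = K"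
  show "\<forall>j\<in>{1..3*k+1}. j mod 6 = 4 \<longrightarrow> z j mod 2 = merge_step K j"
  proof (intro ballI impI)
    fix j assume j: "j \<in> {1..3*k+1}" "j mod 6 = 4"
    then have "(j+2) div 6 \<in> {1..dalpha k}" by (rule dalpha_index)
    moreover have "6*((j+2) div 6) - 2 = j" using mod6_eq_4D[OF j(2)] by linarith
    ultimately have "(j+2) div 6 \<in> K \<longleftrightarrow> odd (z j)"
      unfolding K[symmetric] odd_parts_def by auto
    with j(2) show "z j mod 2 = merge_step K j"
      unfolding merge_step_def by (auto simp: odd_iff_mod_2_eq_one)
  qed
next
  assume z: "\<forall>j\<in>{1..3*k+1}. j mod 6 = 4 \<longrightarrow> z j mod 2 = merge_step K j"
  have "odd (z (6*i-2)) \<longleftrightarrow> i \<in> K" if i: "i \<in> {1..dalpha k}" for i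
  proof -
    have "(6*i-2+2) div 6 = i" using i by simp
    moreover have "1 \<le> i" using i by simp
    then have "6*i-2 = 4 + 6*(i-1)" by simp
    then have m: "(6*i-2) mod 6 = 4" by (simp only: mod_mult_self2) simp
    ultimately have s: "merge_step K (6*i-2) = of_bool (i \<in> K)"
      unfolding merge_step_def by (simp only: simp_thms)
    have "6*i-2 \<in> {1..3*k+1}"
      using i unfolding dalpha_def atLeastAtMost_iff by linarith
    then have "z (6*i-2) mod 2 = of_bool (i \<in> K)"
      using z m unfolding s[symmetric] by blast
    then show ?thesis by (auto simp: odd_iff_mod_2_eq_one)
  qed
  with assms show "odd_parts k z = K" unfolding odd_parts_def by blast
qed

text \<open>At an index \<open>j\<close> that is 4 modulo 6 write \<open>z j\<close> as
  \<open>2 * y j\<close> plus its parity bit. The even part contributes \<open>j * y j\<close>,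
  restoring the full weight, and the bits prescribed by \<open>K\<close> contribute the constant
  \<open>dshift K\<close>.\<close>

lemma card_odd_parts:
  assumes K: "K \<subseteq> {1..dalpha k}"
  shows "card {z \<in> weighted_solutions (3*k+1) dpart m n. odd_parts k z = K} =
    card (weighted_solutions (3*k+1) (\<lambda>i. i) (dshift K + m) n)"
proof (rule bij_betw_same_card)
  let ?N = "3*k+1"
  let ?F = "\<lambda>z. \<lambda>j\<in>{1..?N}. if j mod 6 = 4 then z j div 2 else z j"
  let ?G = "\<lambda>y. \<lambda>j\<in>{1..?N}. if j mod 6 = 4 then 2 * y j + merge_step K j else y j"
  have step: "merge_step K j = 0" if "j mod 6 \<noteq> 4" for j
    using that by (simp add: merge_step_def)
  have step1: "merge_step K j \<le> 1" for j by (simp add: merge_step_def)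
  have G: "(\<Sum>j=1..?N. dpart j * ?G y j) = (\<Sum>j=1..?N. j * y j) + dshift K" for y
  proof -
    have "dpart j * ?G y j = j * y j + dpart j * merge_step K j" if "j \<in> {1..?N}" for j
    proof (cases "j mod 6 = 4")
      case True
      \<comment> \<open>As j + 2 is a multiple of 6, \<open>j\<close> is even and the halving in
        \<open>dpart\<close> is exact.\<close>
      have "even (6 * ((j+2) div 6))" by simp
      then have "even j" unfolding mod6_eq_4D[OF True] by simp
      then have "2 * (j div 2) = j" by simp
      with True that show ?thesis
        unfolding dpart_def by (simp add: algebra_simps flip: mult.assoc)
    next
      case False
      with that step[of j] show ?thesis by (simp add: dpart_def)
    qed
    then have "(\<Sum>j=1..?N. dpart j * ?G y j) = (\<Sum>j=1..?N. j * y j + dpart j * merge_step K j)"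
      by (intro sum.cong) auto
    then show ?thesis by (simp only: sum.distrib sum_merge_step[OF K])
  qed
  have GF: "?G (?F z) = z" if z: "z \<in> {1..?N} \<rightarrow>\<^sub>E UNIV" "odd_parts k z = K" for z
  proof (rule extensionalityI[of _ "{1..?N}"])
    fix j assume j: "j \<in> {1..?N}"
    show "?G (?F z) j = z j"
    proof (cases "j mod 6 = 4")
      case True
      then have "z j mod 2 = merge_step K j"
        using z(2) j unfolding odd_parts_eq_iff[OF K] by blast
      then have "2 * (z j div 2) + merge_step K j = z j" by presburger
      then show ?thesis using j True by simp
    qed (use j in simp)
  qed (use z in \<open>simp_all add: PiE_iff\<close>)
  have FG: "?F (?G y) = y" if y: "y \<in> {1..?N} \<rightarrow>\<^sub>E UNIV" for y
  proof (rule extensionalityI[of _ "{1..?N}"])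
    fix j assume "j \<in> {1..?N}"
    moreover have "(2 * y j + merge_step K j) div 2 = y j" using step1[of j] by linarith
    ultimately show "?F (?G y) j = y j" by simp
  qed (use y in \<open>simp_all add: PiE_iff\<close>)
  show "bij_betw ?F {z \<in> weighted_solutions ?N dpart m n. odd_parts k z = K}
          (weighted_solutions ?N (\<lambda>i. i) (dshift K + m) n)"
  proof (rule bij_betw_byWitness[where f' = ?G])
    show "\<forall>z\<in>{z \<in> weighted_solutions ?N dpart m n. odd_parts k z = K}. ?G (?F z) = z"
      using GF unfolding weighted_solutions_def by blast
    show "\<forall>y\<in>weighted_solutions ?N (\<lambda>i. i) (dshift K + m) n. ?F (?G y) = y"
      using FG unfolding weighted_solutions_def by blast
    show "?F ` {z \<in> weighted_solutions ?N dpart m n. odd_parts k z = K}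
        \<subseteq> weighted_solutions ?N (\<lambda>i. i) (dshift K + m) n"
    proof (rule image_subsetI)
      fix z assume z: "z \<in> {z \<in> weighted_solutions ?N dpart m n. odd_parts k z = K}"
      then have "?G (?F z) = z" using GF unfolding weighted_solutions_def by blast
      with z have "(\<Sum>j=1..?N. dpart j * ?G (?F z) j) + m = n"
        unfolding weighted_solutions_def by simp
      then have "(\<Sum>j=1..?N. j * ?F z j) + (dshift K + m) = n"
        unfolding G by (simp only: add.assoc)
      then show "?F z \<in> weighted_solutions ?N (\<lambda>i. i) (dshift K + m) n"
        unfolding weighted_solutions_def by (simp only: mem_Collect_eq restrict_PiE_iff) auto
    qed
    show "?G ` weighted_solutions ?N (\<lambda>i. i) (dshift K + m) n
        \<subseteq> {z \<in> weighted_solutions ?N dpart m n. odd_parts k z = K}"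
    proof (rule image_subsetI)
      fix y assume "y \<in> weighted_solutions ?N (\<lambda>i. i) (dshift K + m) n"
      then have "(\<Sum>j=1..?N. dpart j * ?G y j) + m = n"
        unfolding G weighted_solutions_def by simp
      then have "?G y \<in> weighted_solutions ?N dpart m n"
        unfolding weighted_solutions_def by (simp only: mem_Collect_eq restrict_PiE_iff) auto
      moreover have "?G y j mod 2 = merge_step K j" if "j \<in> {1..?N}" "j mod 6 = 4" for j
      proof -
        have "(2 * y j + merge_step K j) mod 2 = merge_step K j" using step1[of j] by simp
        with that show ?thesis by simp
      qed
      ultimately show "?G y \<in> {z \<in> weighted_solutions ?N dpart m n. odd_parts k z = K}"
        unfolding odd_parts_eq_iff[OF K] by blast
    qed
  qed
qed

text \<open>Split each subset of \<open>{1..k}\<close> at \<alpha>; \<open>dshift\<close> is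
  additive over the two pieces. Summing over the lower piece runs through all parity patterns and so
  reassembles the solutions with weights \<open>dpart\<close>.\<close>

lemma num_diamonds_eq_sum_dpart:
  "num_diamonds k n =
    (\<Sum>J\<in>Pow {dalpha k + 1..k}. card (weighted_solutions (3*k+1) dpart (dshift J) n))"
proof -
  let ?A = "{1..dalpha k}" and ?B = "{dalpha k + 1..k}"
  have le: "dalpha k \<le> k" by (cases k) (auto simp: dalpha_def)
  have "num_diamonds k n =
    (\<Sum>J\<in>Pow {1..k}. card (weighted_solutions (3*k+1) (\<lambda>i. i) (dshift J) n))"
    by (rule num_diamonds_eq_sum)
  also have "\<dots> = (\<Sum>(J, K)\<in>Pow ?B \<times> Pow ?A.
      card (weighted_solutions (3*k+1) (\<lambda>i. i) (dshift K + dshift J) n))"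
  proof (rule sum.reindex_bij_witness[where i = "\<lambda>(J, K). K \<union> J" and j = "\<lambda>J. (J \<inter> ?B, J \<inter> ?A)"])
    fix J assume J: "J \<in> Pow {1..k}"
    then have eq: "(J \<inter> ?A) \<union> (J \<inter> ?B) = J" by auto
    show "(case (J \<inter> ?B, J \<inter> ?A) of (J, K) \<Rightarrow> K \<union> J) = J" using eq by simp
    show "(J \<inter> ?B, J \<inter> ?A) \<in> Pow ?B \<times> Pow ?A" by blast
    have "dshift ((J \<inter> ?A) \<union> (J \<inter> ?B)) = dshift (J \<inter> ?A) + dshift (J \<inter> ?B)"
      unfolding dshift_def by (rule sum.union_disjoint) auto
    then show "(case (J \<inter> ?B, J \<inter> ?A) of (J, K) \<Rightarrow>
        card (weighted_solutions (3*k+1) (\<lambda>i. i) (dshift K + dshift J) n)) =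
        card (weighted_solutions (3*k+1) (\<lambda>i. i) (dshift J) n)"
      unfolding eq by simp
  qed (use le in auto)
  also have "\<dots> = (\<Sum>J\<in>Pow ?B. \<Sum>K\<in>Pow ?A.
      card (weighted_solutions (3*k+1) (\<lambda>i. i) (dshift K + dshift J) n))"
    by (rule sum.cartesian_product[symmetric])
  also have "\<dots> = (\<Sum>J\<in>Pow ?B. card (weighted_solutions (3*k+1) dpart (dshift J) n))"
  proof (rule sum.cong[OF refl])
    fix J
    have "card (weighted_solutions (3*k+1) dpart (dshift J) n) =
      (\<Sum>K\<in>Pow ?A. card {z \<in> weighted_solutions (3*k+1) dpart (dshift J) n. odd_parts k z = K})"
      by (intro card_eq_sum_fibers finite_weighted_solutions) (auto simp: odd_parts_def dpart_pos)
    also have "\<dots> = (\<Sum>K\<in>Pow ?A. card (weighted_solutions (3*k+1) (\<lambda>i. i) (dshift K + dshift J) n))"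
      by (intro sum.cong refl card_odd_parts) blast
    finally show "(\<Sum>K\<in>Pow ?A. card (weighted_solutions (3*k+1) (\<lambda>i. i) (dshift K + dshift J) n))
        = card (weighted_solutions (3*k+1) dpart (dshift J) n)" ..
  qed
  finally show ?thesis .
qed

subsection \<open>Splitting solutions by residues\<close>

text \<open>Division with remainder by \<open>D div a i\<close> turns each unknown into a remainder
  \<open>t i\<close> and a quotient \<open>w i\<close>. Since \<open>a i * (D div a i) = D\<close>,
  all quotients carry the same weight \<open>D\<close>.\<close>

lemma card_weighted_solutions_residues:
  fixes a :: "nat \<Rightarrow> nat"
  assumes D: "D > 0" and a: "\<And>i. i \<in> {1..N} \<Longrightarrow> a i dvd D"
  shows "card (weighted_solutions N a m n) =
    (\<Sum>t\<in>(\<Pi>\<^sub>E i\<in>{1..N}. {0..D div a i - 1}).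
       card (weighted_solutions N (\<lambda>_. D) ((\<Sum>i=1..N. a i * t i) + m) n))"
proof -
  let ?I = "{1..N}" and ?b = "\<lambda>i. D div a i"
  let ?T = "\<Pi>\<^sub>E i\<in>?I. {0..?b i - 1}"
  let ?R = "\<lambda>z. \<lambda>i\<in>?I. z i mod ?b i"
  have ab: "a i * ?b i = D" if "i \<in> ?I" for i using a[OF that] by simp
  have a0: "a i > 0" and b0: "?b i > 0" if "i \<in> ?I" for i
    using ab[OF that] D by (metis gr0I mult_zero_left mult_zero_right less_irrefl)+
  have "card (weighted_solutions N a m n) =
      (\<Sum>t\<in>?T. card {z \<in> weighted_solutions N a m n. ?R z = t})"
  proof (intro card_eq_sum_fibers finite_weighted_solutions)
    show "finite ?T" by (intro finite_PiE) auto
    show "?R ` weighted_solutions N a m n \<subseteq> ?T"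
    proof (rule image_subsetI)
      fix z :: "nat \<Rightarrow> nat"
      have "z i mod ?b i \<in> {0..?b i - 1}" if "i \<in> ?I" for i
        using mod_less_divisor[OF b0[OF that], of "z i"] by simp
      then show "?R z \<in> ?T" by (simp add: restrict_PiE_iff)
    qed
  qed (use a0 in auto)
  also have "\<dots> = (\<Sum>t\<in>?T. card (weighted_solutions N (\<lambda>_. D) ((\<Sum>i=1..N. a i * t i) + m) n))"
  proof (rule sum.cong[OF refl], rule bij_betw_same_card)
    fix t assume t: "t \<in> ?T"
    have tb: "t i < ?b i" if "i \<in> ?I" for i
      using PiE_mem[OF t that] b0[OF that] by simp
    let ?F = "\<lambda>z. \<lambda>i\<in>?I. z i div ?b i" and ?G = "\<lambda>w. \<lambda>i\<in>?I. t i + ?b i * w i"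
    have G: "(\<Sum>i=1..N. a i * ?G w i) = (\<Sum>i=1..N. a i * t i) + (\<Sum>i=1..N. D * w i)" for w
    proof -
      have "a i * ?G w i = a i * t i + D * w i" if "i \<in> ?I" for i
        using that ab[OF that] by (simp add: distrib_left flip: mult.assoc)
      then have "(\<Sum>i=1..N. a i * ?G w i) = (\<Sum>i=1..N. a i * t i + D * w i)"
        by (rule sum.cong[OF refl])
      then show ?thesis by (simp only: sum.distrib)
    qed
    have GF: "?G (?F z) = z" if z: "z \<in> ?I \<rightarrow>\<^sub>E UNIV" "?R z = t" for z
    proof (rule extensionalityI[of _ ?I])
      fix i assume i: "i \<in> ?I"
      then have "z i mod ?b i = t i" using fun_cong[OF z(2), of i] by simp
      then have "t i + ?b i * (z i div ?b i) = z i" using mod_mult_div_eq[of "z i" "?b i"] by simp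
      then show "?G (?F z) i = z i" using i by simp
    qed (use z in \<open>simp_all add: PiE_iff\<close>)
    have FG: "?F (?G w) = w" if w: "w \<in> ?I \<rightarrow>\<^sub>E UNIV" for w
    proof (rule extensionalityI[of _ ?I])
      fix i assume i: "i \<in> ?I"
      then have "(t i + ?b i * w i) div ?b i = w i" using b0[OF i] tb[OF i] by simp
      then show "?F (?G w) i = w i" using i by simp
    qed (use w in \<open>simp_all add: PiE_iff\<close>)
    have RG: "?R (?G w) = t" for w
    proof (rule extensionalityI[of _ ?I])
      fix i assume i: "i \<in> ?I"
      then have "(t i + ?b i * w i) mod ?b i = t i" using tb[OF i] by simp
      then show "?R (?G w) i = t i" using i by simp
    qed (use t in \<open>simp_all add: PiE_iff\<close>)
    show "bij_betw ?F {z \<in> weighted_solutions N a m n. ?R z = t}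
        (weighted_solutions N (\<lambda>_. D) ((\<Sum>i=1..N. a i * t i) + m) n)"
    proof (rule bij_betw_byWitness[where f' = ?G])
      show "\<forall>z\<in>{z \<in> weighted_solutions N a m n. ?R z = t}. ?G (?F z) = z"
        using GF unfolding weighted_solutions_def by blast
      show "\<forall>w\<in>weighted_solutions N (\<lambda>_. D) ((\<Sum>i=1..N. a i * t i) + m) n. ?F (?G w) = w"
        using FG unfolding weighted_solutions_def by blast
      show "?F ` {z \<in> weighted_solutions N a m n. ?R z = t}
          \<subseteq> weighted_solutions N (\<lambda>_. D) ((\<Sum>i=1..N. a i * t i) + m) n"
      proof (rule image_subsetI)
        fix z assume z: "z \<in> {z \<in> weighted_solutions N a m n. ?R z = t}"
        then have "?G (?F z) = z" using GF unfolding weighted_solutions_def by blast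
        with z have "(\<Sum>i=1..N. a i * ?G (?F z) i) + m = n"
          unfolding weighted_solutions_def by simp
        then have "(\<Sum>i=1..N. D * ?F z i) + ((\<Sum>i=1..N. a i * t i) + m) = n"
          unfolding G by (simp only: ac_simps)
        then show "?F z \<in> weighted_solutions N (\<lambda>_. D) ((\<Sum>i=1..N. a i * t i) + m) n"
          unfolding weighted_solutions_def by (simp only: mem_Collect_eq restrict_PiE_iff) auto
      qed
      show "?G ` weighted_solutions N (\<lambda>_. D) ((\<Sum>i=1..N. a i * t i) + m) n
          \<subseteq> {z \<in> weighted_solutions N a m n. ?R z = t}"
      proof (rule image_subsetI)
        fix w assume "w \<in> weighted_solutions N (\<lambda>_. D) ((\<Sum>i=1..N. a i * t i) + m) n"
        then have "(\<Sum>i=1..N. a i * ?G w i) + m = n"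
          unfolding G weighted_solutions_def by simp
        then have "?G w \<in> weighted_solutions N a m n"
          unfolding weighted_solutions_def by (simp only: mem_Collect_eq restrict_PiE_iff) auto
        then show "?G w \<in> {z \<in> weighted_solutions N a m n. ?R z = t}" using RG by blast
      qed
    qed
  qed
  finally show ?thesis .
qed

section \<open>Equal weights and polynomial expansions\<close>

text \<open>Stars and bars, transferred from lists; list positions start at 0 and function indices
  at 1.\<close>

lemma card_functions_sum:
  "card {w \<in> {1..N} \<rightarrow>\<^sub>E UNIV. (\<Sum>i=1..N. w i) = q} = (q + N - 1) choose (q::nat)"
proof -
  let ?F = "\<lambda>w::nat \<Rightarrow> nat. map w [1..<Suc N]"
  let ?G = "\<lambda>l::nat list. \<lambda>i\<in>{1..N}. l ! (i - 1)"
  have sum: "sum_list (?F w) = (\<Sum>i=1..N. w i)" for w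
    unfolding interv_sum_list_conv_sum_set_nat set_upt atLeastLessThanSuc_atLeastAtMost ..
  have FG: "?F (?G l) = l" if "length l = N" for l
    using that by (intro nth_equalityI) (auto simp del: upt_Suc)
  have "bij_betw ?F {w \<in> {1..N} \<rightarrow>\<^sub>E UNIV. (\<Sum>i=1..N. w i) = q} {l. size l = N \<and> sum_list l = q}"
  proof (rule bij_betw_byWitness[where f' = ?G])
    show "\<forall>w\<in>{w \<in> {1..N} \<rightarrow>\<^sub>E UNIV. (\<Sum>i=1..N. w i) = q}. ?G (?F w) = w"
    proof
      fix w assume w: "w \<in> {w \<in> {1..N} \<rightarrow>\<^sub>E UNIV. (\<Sum>i=1..N. w i) = q}"
      show "?G (?F w) = w"
        by (rule extensionalityI[of _ "{1..N}"])
           (use w in \<open>auto simp: PiE_iff simp del: upt_Suc\<close>)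
    qed
    show "\<forall>l\<in>{l. size l = N \<and> sum_list l = q}. ?F (?G l) = l" using FG by blast
    show "?F ` {w \<in> {1..N} \<rightarrow>\<^sub>E UNIV. (\<Sum>i=1..N. w i) = q} \<subseteq> {l. size l = N \<and> sum_list l = q}"
      using sum by auto
    show "?G ` {l. size l = N \<and> sum_list l = q} \<subseteq> {w \<in> {1..N} \<rightarrow>\<^sub>E UNIV. (\<Sum>i=1..N. w i) = q}"
    proof (rule image_subsetI)
      fix l assume "l \<in> {l. size l = N \<and> sum_list l = q}"
      then have "(\<Sum>i=1..N. ?G l i) = q" using sum[of "?G l"] FG[of l] by simp
      then show "?G l \<in> {w \<in> {1..N} \<rightarrow>\<^sub>E UNIV. (\<Sum>i=1..N. w i) = q}"
        by (simp only: mem_Collect_eq restrict_PiE_iff) auto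
    qed
  qed
  then show ?thesis by (simp only: bij_betw_same_card card_length_sum_list)
qed

text \<open>
  For \<open>-M \<le> q < 0\<close> there are no solutions and the polynomial vanishes, so the formula
  persists slightly below \<open>0\<close>. This range is what makes the result valid from the
  threshold on.
\<close>

lemma card_weighted_solutions_const:
  fixes q :: int
  assumes D: "D > 0" and q: "int n - int s = int D * q" and "- int M \<le> q"
  shows "real (card (weighted_solutions (Suc M) (\<lambda>_. D) s n)) = pochhammer (real_of_int q + 1) M / fact M"
proof -
  have eq: "weighted_solutions (Suc M) (\<lambda>_. D) s n =
      {w \<in> {1..Suc M} \<rightarrow>\<^sub>E UNIV. int (\<Sum>i=1..Suc M. w i) = q}"
  proof -
    have "(\<Sum>i=1..Suc M. D * w i) + s = n \<longleftrightarrow> int (\<Sum>i=1..Suc M. w i) = q" for w :: "nat \<Rightarrow> nat"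
    proof -
      have "(\<Sum>i=1..Suc M. D * w i) + s = n \<longleftrightarrow> int D * int (\<Sum>i=1..Suc M. w i) = int n - int s"
        unfolding sum_distrib_left[symmetric] of_nat_mult[symmetric] by linarith
      then show ?thesis unfolding q using D by simp
    qed
    then show ?thesis unfolding weighted_solutions_def by blast
  qed
  show ?thesis
  proof (cases "q \<ge> 0")
    case True
    then obtain p where p: "q = int p" by (metis nonneg_int_cases)
    have "card (weighted_solutions (Suc M) (\<lambda>_. D) s n) = (p + M) choose p"
      unfolding eq p of_nat_eq_iff card_functions_sum by simp
    \<comment> \<open>With the fixed lower index \<open>M\<close> the binomial coefficient is a
      polynomial in \<open>p\<close>.\<close>
    also have "\<dots> = (p + M) choose M" using binomial_symmetric[of p "p+M"] by simp
    finally show ?thesis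
      unfolding p by (simp add: binomial_gbinomial gbinomial_pochhammer')
  next
    case False
    then have "{w \<in> {1..Suc M} \<rightarrow>\<^sub>E UNIV. int (\<Sum>i=1..Suc M. w i) = q} = {}"
      using of_nat_0_le_iff by blast
    \<comment> \<open>One of the factors q + 1, ..., q + M is zero, because -M \<le> q \<le>
      -1.\<close>
    moreover have "pochhammer (real_of_int q + 1) M = 0"
      unfolding pochhammer_eq_0_iff
    proof (intro exI conjI)
      show "nat (- q - 1) < M" using False assms(3) by linarith
      show "real_of_int q + 1 = - real (nat (- q - 1))" using False by simp
    qed
    ultimately show ?thesis unfolding eq by (simp only: card.empty of_nat_0 div_0)
  qed
qed

text \<open>Divide the Stirling expansion of x(x+1)...(x+M) by x. At x = 0, where this is
  impossible, both sides equal M!.\<close>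

lemma pochhammer_plus1_stirling:
  fixes x :: "'a :: field_char_0"
  shows "pochhammer (x + 1) M = (\<Sum>l=0..M. of_nat (stirling (Suc M) (Suc l)) * x ^ l)"
proof (cases "x = 0")
  case True
  have "(\<Sum>l=0..M. of_nat (stirling (Suc M) (Suc l)) * (0::'a) ^ l) = of_nat (stirling (Suc M) (Suc 0))"
    by (subst sum.atLeast_Suc_atMost) auto
  also have "\<dots> = pochhammer (0 + 1) M"
    unfolding stirling_Suc_n_1 by (simp flip: pochhammer_fact)
  finally show ?thesis unfolding True ..
next
  case False
  have "x * pochhammer (x + 1) M = (\<Sum>l\<le>Suc M. of_nat (stirling (Suc M) l) * x ^ l)"
    unfolding stirling_pochhammer pochhammer_rec ..
  also have "\<dots> = x * (\<Sum>l\<le>M. of_nat (stirling (Suc M) (Suc l)) * x ^ l)"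
    by (subst sum.atMost_Suc_shift) (simp add: sum_distrib_left mult.left_commute del: stirling.simps)
  finally show ?thesis using False by (simp add: atMost_atLeast0)
qed

text \<open>This identifies \<open>dcoeff_term k j s\<close> as the coefficient of X^j: expand each
  power of X - s by the binomial theorem and interchange the sums over j \<le> l.\<close>

lemma sum_dcoeff_term:
  "(\<Sum>j=0..3*k. dcoeff_term k j s * X ^ j) =
   (\<Sum>l=0..3*k. real (stirling (3*k+1) (l+1)) * ((X - real s) / real (dperiod k)) ^ l)"
proof -
  let ?c = "\<lambda>l. real (stirling (3*k+1) (l+1)) / real (dperiod k) ^ l"
  let ?g = "\<lambda>j l. ?c l * (real (l choose j) * X ^ j * (- real s) ^ (l - j))"
  have "(\<Sum>j=0..3*k. dcoeff_term k j s * X ^ j) = (\<Sum>j=0..3*k. \<Sum>l | l \<in> {0..3*k} \<and> j \<le> l. ?g j l)"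
  proof (rule sum.cong[OF refl])
    fix j
    have "{l. l \<in> {0..3*k} \<and> j \<le> l} = {j..3*k}" by auto
    moreover have "(- real s) ^ i = (-1) ^ i * real s ^ i" for i by (rule power_minus)
    ultimately show "dcoeff_term k j s * X ^ j = (\<Sum>l | l \<in> {0..3*k} \<and> j \<le> l. ?g j l)"
      unfolding dcoeff_term_def sum_distrib_right
      by (simp only:) (intro sum.cong refl, simp)
  qed
  also have "\<dots> = (\<Sum>l=0..3*k. \<Sum>j | j \<in> {0..3*k} \<and> j \<le> l. ?g j l)"
    by (rule sum.swap_restrict) auto
  also have "\<dots> = (\<Sum>l=0..3*k. ?c l * (X - real s) ^ l)"
  proof (rule sum.cong[OF refl])
    fix l assume "l \<in> {0..3*k}"
    then have "{j. j \<in> {0..3*k} \<and> j \<le> l} = {..l}" by auto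
    moreover have "(X - real s) ^ l = (\<Sum>j\<le>l. real (l choose j) * X ^ j * (- real s) ^ (l - j))"
      using binomial_ring[of X "- real s" l] by simp
    ultimately show "(\<Sum>j | j \<in> {0..3*k} \<and> j \<le> l. ?g j l) = ?c l * (X - real s) ^ l"
      by (simp only: sum_distrib_left)
  qed
  finally show ?thesis by (simp add: power_divide)
qed

subsection \<open>The quasi-polynomial\<close>

lemma dpart_dvd_dperiod: "i \<in> {1..3*k+1} \<Longrightarrow> dpart i dvd dperiod k"
  unfolding dperiod_def by (intro dvd_Lcm imageI)

lemma dperiod_pos: "dperiod k > 0"
proof -
  have "0 \<notin> dpart ` {1..3*k+1}"
  proof
    assume "0 \<in> dpart ` {1..3*k+1}"
    then obtain j where "j \<in> {1..3*k+1}" "dpart j = 0" by (elim imageE) simp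
    then show False using dpart_pos[of j] by simp
  qed
  then have "dperiod k \<noteq> 0" unfolding dperiod_def by (subst Lcm_0_iff) auto
  then show ?thesis by simp
qed

text \<open>Each of the 3k+1 summands is below the period. This bounds from below the quotient at
  which the counting polynomial is evaluated.\<close>

lemma dlincomb_less:
  assumes "t \<in> (\<Pi>\<^sub>E i\<in>{1..3*k+1}. {0..dperiod k div dpart i - 1})"
  shows "dlincomb k t < (3*k+1) * dperiod k"
proof -
  let ?D = "dperiod k"
  have "dlincomb k t \<le> (\<Sum>i=1..3*k+1. ?D - 1)"
    unfolding dlincomb_def
  proof (rule sum_mono)
    fix i assume i: "i \<in> {1..3*k+1}"
    have eq: "dpart i * (?D div dpart i) = ?D" using dpart_dvd_dperiod[OF i] by simp
    then have "?D div dpart i > 0" using dperiod_pos[of k] by (metis gr0I mult_0_right less_irrefl)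
    then have "t i < ?D div dpart i" using PiE_mem[OF assms i] by simp
    moreover have "dpart i > 0" using i by (intro dpart_pos) simp
    ultimately have "dpart i * t i < dpart i * (?D div dpart i)" by simp
    then show "dpart i * t i \<le> ?D - 1" unfolding eq by simp
  qed
  also have "\<dots> = (3*k+1) * (?D - 1)" by simp
  also have "\<dots> < (3*k+1) * ?D"
    using dperiod_pos[of k] by (intro mult_strict_left_mono) auto
  finally show ?thesis .
qed

text \<open>Tuples in the wrong residue class admit no solution. For the others the prescribed sum
  \<open>q\<close> of the quotients is an integer not below -3k, within the range where the
  polynomial count is valid.\<close>

lemma card_weighted_solutions_dpart:
  assumes m: "dshift J \<le> n"
  shows "real (card (weighted_solutions (3*k+1) dpart (dshift J) n)) =
    (\<Sum>t\<in>dtuples k n J. 1 / fact (3*k) *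
      (\<Sum>l=0..3*k. real (stirling (3*k+1) (l+1)) *
         ((real n - real (dshift J) - real (dlincomb k t)) / real (dperiod k)) ^ l))"
proof -
  let ?T = "\<Pi>\<^sub>E i\<in>{1..3*k+1}. {0..dperiod k div dpart i - 1}"
  let ?D = "dperiod k" and ?m = "dshift J"
  let ?W = "\<lambda>t. weighted_solutions (3*k+1) (\<lambda>_. ?D) (dlincomb k t + ?m) n"
  have "card (weighted_solutions (3*k+1) dpart ?m n) = (\<Sum>t\<in>?T. card (?W t))"
    unfolding dlincomb_def by (rule card_weighted_solutions_residues[OF dperiod_pos dpart_dvd_dperiod])
  then have "real (card (weighted_solutions (3*k+1) dpart ?m n)) = (\<Sum>t\<in>?T. real (card (?W t)))"
    by simp
  also have "\<dots> = (\<Sum>t\<in>dtuples k n J. 1 / fact (3*k) *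
      (\<Sum>l=0..3*k. real (stirling (3*k+1) (l+1)) *
         ((real n - real ?m - real (dlincomb k t)) / real ?D) ^ l))"
  proof (rule sum.mono_neutral_cong_right)
    show "finite ?T" by (intro finite_PiE) auto
    show "dtuples k n J \<subseteq> ?T" unfolding dtuples_def by blast
    show "\<forall>t\<in>?T - dtuples k n J. real (card (?W t)) = 0"
    proof
      fix t assume t: "t \<in> ?T - dtuples k n J"
      have False if w: "w \<in> ?W t" for w
      proof -
        have "n = ?D * (\<Sum>i=1..3*k+1. w i) + dlincomb k t + ?m"
          using w unfolding weighted_solutions_def sum_distrib_left by simp
        then have "int n - int ?m = int (dlincomb k t) + int ?D * int (\<Sum>i=1..3*k+1. w i)"
          by (simp only: of_nat_add of_nat_mult)
        then have "[int (dlincomb k t) = int n - int ?m] (mod int ?D)"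
          by (simp only: cong_def mod_mult_self2)
        with t show False unfolding dtuples_def by blast
      qed
      then have "?W t = {}" by blast
      then show "real (card (?W t)) = 0" by simp
    qed
    fix t assume t: "t \<in> dtuples k n J"
    then have "[int n - int ?m = int (dlincomb k t)] (mod int ?D)"
      unfolding dtuples_def by (simp add: cong_sym)
    then obtain q where q0: "int n - int ?m - int (dlincomb k t) = int ?D * q"
      unfolding cong_iff_dvd_diff by (rule dvdE)
    then have q: "int n - int (dlincomb k t + ?m) = int ?D * q" by simp
    \<comment> \<open>Since n - m is nonnegative, D * q exceeds -(3k+1) * D; integrality of
      \<open>q\<close> then sharpens q > -(3k+1) to q \<ge> -3k.\<close>
    have "dlincomb k t < (3*k+1) * ?D" using t dlincomb_less unfolding dtuples_def by blast
    then have "int (dlincomb k t) < int ((3*k+1) * ?D)" by (simp only: of_nat_less_iff)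
    then have "int ?D * q > int ?D * (- int (3*k+1))"
      using m unfolding q0[symmetric] by (simp add: algebra_simps)
    then have "- int (3*k+1) < q" using dperiod_pos[of k] by (simp only: mult_less_cancel_left_pos of_nat_0_less_iff)
    then have "- int (3*k) \<le> q" by simp
    from card_weighted_solutions_const[OF dperiod_pos q this]
    have "real (card (?W t)) = pochhammer (real_of_int q + 1) (3*k) / fact (3*k)"
      by simp
    also have "real_of_int q = (real n - real ?m - real (dlincomb k t)) / real ?D"
    proof -
      have "real_of_int (int n - int ?m - int (dlincomb k t)) = real_of_int (int ?D * q)"
        unfolding q0 ..
      then show ?thesis using dperiod_pos[of k] by (simp add: field_simps)
    qed
    finally show "real (card (?W t)) = 1 / fact (3*k) *
      (\<Sum>l=0..3*k. real (stirling (3*k+1) (l+1)) *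
         ((real n - real ?m - real (dlincomb k t)) / real ?D) ^ l)"
      unfolding pochhammer_plus1_stirling by simp
  qed
  finally show ?thesis .
qed

section \<open>The threshold as the largest shift\<close>

text \<open>An arithmetic progression, doubled to avoid the division in
  \<open>dthreshold\<close>.\<close>

lemma dshift_interval:
  "a \<le> k \<Longrightarrow> 2 * dshift {a+1..k} = (k - a) * (3*k + 3*a + 1)"
proof (induction k rule: dec_induct)
  case (step k)
  have "{a+1..Suc k} = insert (Suc k) {a+1..k}" using step.hyps by auto
  then have "dshift {a+1..Suc k} = (3*k+2) + dshift {a+1..k}"
    by (simp add: dshift_def)
  then have "2 * dshift {a+1..Suc k} = 2*(3*k+2) + (k - a) * (3*k + 3*a + 1)"
    using step.IH by simp
  \<comment> \<open>Writing k = a + d removes the truncated subtraction before the algebra.\<close>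
  also from step.hyps obtain d where "k = a + d" using le_Suc_ex by blast
  then have "2*(3*k+2) + (k - a) * (3*k + 3*a + 1) = (Suc k - a) * (3*Suc k + 3*a + 1)"
    by (simp add: algebra_simps)
  finally show ?case .
qed (simp add: dshift_def)

text \<open>The threshold is the shift of the full set \<open>{dalpha k + 1..k}\<close>, and
  \<open>dshift\<close> grows with the set.\<close>

lemma dshift_le_dthreshold:
  assumes "J \<subseteq> {dalpha k + 1..k}"
  shows "dshift J \<le> dthreshold k"
proof -
  have "dalpha k \<le> k" by (cases k) (auto simp: dalpha_def)
  then have "dthreshold k = dshift {dalpha k + 1..k}"
    by (simp only: dthreshold_def flip: dshift_interval)
  moreover have "dshift J \<le> dshift {dalpha k + 1..k}"
    unfolding dshift_def using assms by (intro sum_mono2) auto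
  ultimately show ?thesis by simp
qed

text \<open>
  \<open>x J\<close> is the quantity in whose powers one expands: \<open>n - m\<^sub>J\<close> or \<open>n\<close> below.
\<close>

lemma num_diamonds_eq_dcoeff_sum:
  assumes n: "n \<ge> dthreshold k"
    and x: "\<And>J t. x J - real (s J t) = real n - real (dshift J) - real (dlincomb k t)"
  shows "real (num_diamonds k n) = 1 / fact (3*k) *
    (\<Sum>j=0..3*k. \<Sum>J\<in>Pow {dalpha k + 1..k}. \<Sum>t\<in>dtuples k n J. dcoeff_term k j (s J t) * x J ^ j)"
proof -
  have "real (num_diamonds k n) = (\<Sum>J\<in>Pow {dalpha k + 1..k}.
      real (card (weighted_solutions (3*k+1) dpart (dshift J) n)))"
    unfolding num_diamonds_eq_sum_dpart by (rule of_nat_sum)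
  also have "\<dots> = (\<Sum>J\<in>Pow {dalpha k + 1..k}. \<Sum>t\<in>dtuples k n J. 1 / fact (3*k) *
      (\<Sum>j=0..3*k. dcoeff_term k j (s J t) * x J ^ j))"
  proof (rule sum.cong[OF refl])
    fix J assume "J \<in> Pow {dalpha k + 1..k}"
    then have "dshift J \<le> n" using dshift_le_dthreshold[of J k] n by simp
    then show "real (card (weighted_solutions (3*k+1) dpart (dshift J) n)) =
        (\<Sum>t\<in>dtuples k n J. 1 / fact (3*k) * (\<Sum>j=0..3*k. dcoeff_term k j (s J t) * x J ^ j))"
      unfolding sum_dcoeff_term x by (rule card_weighted_solutions_dpart)
  qed
  also have "\<dots> = (\<Sum>J\<in>Pow {dalpha k + 1..k}. \<Sum>j=0..3*k. \<Sum>t\<in>dtuples k n J.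
      1 / fact (3*k) * (dcoeff_term k j (s J t) * x J ^ j))"
    unfolding sum_distrib_left by (intro sum.cong refl sum.swap)
  also have "\<dots> = 1 / fact (3*k) * (\<Sum>j=0..3*k. \<Sum>J\<in>Pow {dalpha k + 1..k}. \<Sum>t\<in>dtuples k n J.
      dcoeff_term k j (s J t) * x J ^ j)"
    unfolding sum_distrib_left by (rule sum.swap)
  finally show ?thesis .
qed

section \<open>Uniqueness and periodicity of the coefficients\<close>

text \<open>If some coefficients differed, the difference would be a nonzero polynomial with
  infinitely many roots.\<close>

lemma polynomial_coeffs_eqI:
  fixes b c :: "nat \<Rightarrow> real"
  assumes "infinite X" and "\<And>x. x \<in> X \<Longrightarrow> (\<Sum>j=0..d. b j * x ^ j) = (\<Sum>j=0..d. c j * x ^ j)"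
    and "j \<le> d"
  shows "b j = c j"
proof (rule ccontr)
  assume "b j \<noteq> c j"
  then have "finite {x. (\<Sum>i\<le>d. (b i - c i) * x ^ i) = 0}"
    using assms(3) unfolding polyfun_finite_roots by auto
  moreover have "X \<subseteq> {x. (\<Sum>i\<le>d. (b i - c i) * x ^ i) = 0}"
    using assms(2) by (auto simp: left_diff_distrib sum_subtractf atMost_atLeast0)
  ultimately show False using assms(1) finite_subset by blast
qed

text \<open>The proposed coefficients depend on \<open>n\<close> only through this index set, so its
  invariance makes them periodic.\<close>

lemma dtuples_add_dperiod: "dtuples k (n + r * dperiod k) J = dtuples k n J"
proof -
  have "int (n + r * dperiod k) - int (dshift J) = int n - int (dshift J) + int r * int (dperiod k)"
    by simp
  then show ?thesis unfolding dtuples_def cong_def by (simp only: mod_mult_self1)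
qed

theorem corollary3p3:
  fixes k n :: nat
  assumes "k \<ge> 1" and "n \<ge> dthreshold k"
  shows "(\<forall>f. quasi_polynomial_coeffs k f \<longrightarrow>
           (\<forall>j\<le>3*k. f j n = 1 / fact (3*k) *
             (\<Sum>J\<in>Pow {dalpha k + 1..k}. \<Sum>t\<in>dtuples k n J.
                dcoeff_term k j (dlincomb k t + dshift J)))) \<and>
         real (num_diamonds k n) = 1 / fact (3*k) *
           (\<Sum>j=0..3*k. \<Sum>J\<in>Pow {dalpha k + 1..k}. \<Sum>t\<in>dtuples k n J.
              dcoeff_term k j (dlincomb k t) * (real n - real (dshift J)) ^ j)"
proof (intro conjI allI impI)
  show "real (num_diamonds k n) = 1 / fact (3*k) *
           (\<Sum>j=0..3*k. \<Sum>J\<in>Pow {dalpha k + 1..k}. \<Sum>t\<in>dtuples k n J.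
              dcoeff_term k j (dlincomb k t) * (real n - real (dshift J)) ^ j)"
    \<comment> \<open>Expansion in powers of n - m, with \<open>s\<close> the bare linear
      form.\<close>
    by (rule num_diamonds_eq_dcoeff_sum[OF assms(2)]) simp
next
  fix f j assume f: "quasi_polynomial_coeffs k f" and j: "j \<le> 3*k"
  let ?D = "dperiod k"
  let ?g = "\<lambda>j. 1 / fact (3*k) * (\<Sum>J\<in>Pow {dalpha k + 1..k}. \<Sum>t\<in>dtuples k n J.
                dcoeff_term k j (dlincomb k t + dshift J))"
  \<comment> \<open>Along this progression both families of coefficients are constant, so two
    quasi-polynomials become two ordinary polynomials that agree at infinitely many points.\<close>
  let ?X = "range (\<lambda>r. real (n + r * ?D))"
  have fper: "f i (n + r * ?D) = f i n" if "i \<le> 3*k" for i r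
  proof (induction r)
    case (Suc r)
    have "n + r * ?D \<ge> dthreshold k" using assms(2) by simp
    then have "f i ((n + r * ?D) + ?D) = f i (n + r * ?D)"
      using f that unfolding quasi_polynomial_coeffs_def by blast
    then show ?case using Suc by (simp add: ac_simps)
  qed simp
  show "f j n = ?g j"
  proof (rule polynomial_coeffs_eqI[where X = ?X and d = "3*k" and b = "\<lambda>i. f i n", OF _ _ j])
    have "inj (\<lambda>r. real (n + r * ?D))"
      using dperiod_pos[of k] by (intro injI) simp
    then show "infinite ?X" by (simp only: finite_image_iff infinite_UNIV_nat not_False_eq_True)
    fix x assume "x \<in> ?X"
    then obtain r where x: "x = real (n + r * ?D)" by blast
    define n' where "n' = n + r * ?D"
    have n': "n' \<ge> dthreshold k" using assms(2) unfolding n'_def by simp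
    have "(\<Sum>i=0..3*k. f i n * x ^ i) = (\<Sum>i=0..3*k. f i n' * real n' ^ i)"
      by (rule sum.cong) (auto simp: x n'_def fper simp del: of_nat_add)
    also have "\<dots> = real (num_diamonds k n')"
      using f n' unfolding quasi_polynomial_coeffs_def by simp
    \<comment> \<open>Expansion in powers of \<open>n'\<close> itself; the shift moves into
      \<open>s\<close>.\<close>
    also have "\<dots> = 1 / fact (3*k) *
      (\<Sum>j=0..3*k. \<Sum>J\<in>Pow {dalpha k + 1..k}. \<Sum>t\<in>dtuples k n' J.
         dcoeff_term k j (dlincomb k t + dshift J) * real n' ^ j)"
      by (rule num_diamonds_eq_dcoeff_sum[OF n']) simp
    also have "\<dots> = (\<Sum>i=0..3*k. ?g i * x ^ i)"
      unfolding n'_def dtuples_add_dperiod x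
      by (simp only: sum_distrib_left sum_distrib_right mult.assoc)
    finally show "(\<Sum>i=0..3*k. f i n * x ^ i) = (\<Sum>i=0..3*k. ?g i * x ^ i)" .
  qed
qed

end
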